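(* Let $I\subset S=\mathbb{K}[x_1,\ldots,x_n]$ be an $\mathfrak{m}$-primary monomial ideal and $I=\mathfrak{q}_1 \cap \cdots \cap \mathfrak{q}_r$ be an irredundant irreducible decomposition of $I$. Then for all integers $k\geq 1$, $$\mathrm{sat}(I^{\{k\}})=\max\{\mathrm{sat}(\mathfrak{q}_i^k) : i=1, \ldots , r\} \leq \mathrm{sat}(I^k).$$
   Context: $\mathbb{K}$ is a field, $S=\mathbb{K}[x_1,\ldots,x_n]$ is the polynomial ring ($n\ge 1$) and $\mathfrak{m}=(x_1,\ldots,x_n)$. For ideals $I,J$ of $S$, $I\colon J=\{f\in S : fJ\subseteq I\}$, and $\mathfrak{m}^0=S$. The saturation number of an ideal $I\subset S$ is $\mathrm{sat}(I)=\min\{k\geq 0 : I\colon\mathfrak{m}^k=I\colon\mathfrak{m}^{k+1}\}$. An irreducible monomial ideal is one of the form $(x_{i_1}^{c_1},\ldots,x_{i_p}^{c_p})$ with distinct indices and all $c_j>0$. Every proper monomial ideal $I$ has a decomposition $I=\mathfrak{q}_1\cap\cdots\cap\mathfrak{q}_r$ into irreducible monomial ideals that is irredundant (no $\mathfrak{q}_i$ can be omitted), unique up to order; the $\{k\}$-th symbolic power of $I$ is then defined by $I^{\{k\}}:=\bigcap_{i=1}^{r}\mathfrak{q}_i^k$. *)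

theory Defs
  imports Complex_Main "HOL-Library.Poly_Mapping"
begin

text \<open>
  The polynomial ring \<open>K[x\<^sub>1, \<dots>, x\<^sub>n]\<close> is the monoid algebra of the exponent monoid
  \<open>'n \<Rightarrow>\<^sub>0 nat\<close>, where the variables are indexed by a finite type \<open>'n\<close> with \<open>n\<close> elements
  (\<open>n \<ge> 1\<close>, since types are inhabited).
\<close>

type_synonym ('n, 'k) mpoly = "('n \<Rightarrow>\<^sub>0 nat) \<Rightarrow>\<^sub>0 'k"

text \<open>
  Ideals of a commutative ring are its submodules as a module over itself:
  \<open>ideal.subspace I\<close> means that \<open>I\<close> is an ideal, and \<open>ideal.span A\<close> is the ideal generated by \<open>A\<close>.
\<close>

global_interpretation ideal: module "(*) :: 'a \<Rightarrow> 'a \<Rightarrow> 'a::comm_ring_1"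
  by standard (simp_all add: algebra_simps)

definition ideal_prod :: "'a::comm_ring_1 set \<Rightarrow> 'a set \<Rightarrow> 'a set" where
  "ideal_prod I J = ideal.span {a * b | a b. a \<in> I \<and> b \<in> J}"

primrec ideal_power :: "'a::comm_ring_1 set \<Rightarrow> nat \<Rightarrow> 'a set" where
  "ideal_power I 0 = UNIV"
| "ideal_power I (Suc k) = ideal_prod I (ideal_power I k)"

definition ideal_colon :: "'a::comm_ring_1 set \<Rightarrow> 'a set \<Rightarrow> 'a set" where
  "ideal_colon I J = {f. \<forall>g\<in>J. f * g \<in> I}"

definition radical :: "'a::comm_ring_1 set \<Rightarrow> 'a set" where
  "radical I = {f. \<exists>k. f ^ k \<in> I}"

definition primary_ideal :: "'a::comm_ring_1 set \<Rightarrow> bool" where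
  "primary_ideal I \<longleftrightarrow> ideal.subspace I \<and> I \<noteq> UNIV \<and>
     (\<forall>a b. a * b \<in> I \<longrightarrow> a \<in> I \<or> b \<in> radical I)"

definition monomial :: "('n \<Rightarrow>\<^sub>0 nat) \<Rightarrow> ('n, 'k::field) mpoly" where
  "monomial m = Poly_Mapping.single m 1"

definition Var :: "'n \<Rightarrow> ('n, 'k::field) mpoly" where
  "Var i = monomial (Poly_Mapping.single i 1)"

definition max_ideal :: "('n::finite, 'k::field) mpoly set" where
  "max_ideal = ideal.span {Var i | i. True}"

definition max_ideal_primary :: "('n::finite, 'k::field) mpoly set \<Rightarrow> bool" where
  "max_ideal_primary I \<longleftrightarrow> primary_ideal I \<and> radical I = max_ideal"

definition monomial_ideal :: "('n::finite, 'k::field) mpoly set \<Rightarrow> bool" where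
  "monomial_ideal I \<longleftrightarrow> (\<exists>M. I = ideal.span (monomial ` M))"

definition sat :: "('n::finite, 'k::field) mpoly set \<Rightarrow> nat" where
  "sat I = (LEAST k. ideal_colon I (ideal_power max_ideal k) =
                     ideal_colon I (ideal_power max_ideal (Suc k)))"

text \<open>
  The index set \<open>V\<close> may be empty, so that the zero ideal is irreducible; it is a proper monomial
  ideal and would otherwise have no irreducible decomposition.
\<close>

definition irreducible_monomial_ideal :: "('n::finite, 'k::field) mpoly set \<Rightarrow> bool" where
  "irreducible_monomial_ideal Q \<longleftrightarrow>
     (\<exists>V c. (\<forall>i\<in>V. c i > 0) \<and> Q = ideal.span ((\<lambda>i. Var i ^ c i) ` V))"

definition irredundant_irreducible_decomp ::
    "('n::finite, 'k::field) mpoly set \<Rightarrow> nat \<Rightarrow> (nat \<Rightarrow> ('n, 'k) mpoly set) \<Rightarrow> bool" where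
  "irredundant_irreducible_decomp I r q \<longleftrightarrow>
     (\<forall>i\<in>{1..r}. irreducible_monomial_ideal (q i)) \<and>
     I = (\<Inter>i\<in>{1..r}. q i) \<and>
     (\<forall>j\<in>{1..r}. (\<Inter>i\<in>{1..r} - {j}. q i) \<noteq> I)"

text \<open>
  The description below is proper for every proper monomial ideal \<open>I\<close>, because its irredundant
  irreducible decomposition exists and is unique up to the order of the components.
\<close>

definition symbolic_power :: "('n::finite, 'k::field) mpoly set \<Rightarrow> nat \<Rightarrow> ('n, 'k) mpoly set" where
  "symbolic_power I k =
     (THE J. \<exists>r q. irredundant_irreducible_decomp I r q \<and> J = (\<Inter>i\<in>{1..r}. ideal_power (q i) k))"

end

(*
  If an ideal J contains a power of the maximal ideal m, then J : m^k = J : m^(k+1) forces the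
  chain of colon ideals to be constant from k on, hence equal to S, so that m^k is contained in J.
  Thus sat J is the least k with m^k contained in J: this turns intersections into maxima and
  reverses inclusions, and I^k is contained in each q_i^k.

  That the symbolic power is well defined rests on the primality of irreducible monomial ideals
  with respect to intersection: if Q contains the intersection of finitely many irreducible
  monomial ideals, then it contains one of them.
*)
theory Submission
  imports Defs
begin

section \<open>Powers and products of ideals\<close>

lemma subspace_ideal_power: "ideal.subspace (ideal_power I k)"
  by (cases k) (simp_all add: ideal_prod_def)

lemma ideal_power_mono: "I \<subseteq> J \<Longrightarrow> ideal_power I k \<subseteq> ideal_power J k"
proof (induction k)
  case (Suc k)
  then show ?case
    unfolding ideal_power.simps ideal_prod_def by (intro ideal.span_mono) blast
qed simp

lemma ideal_power_Suc_subset: "ideal_power I (Suc k) \<subseteq> ideal_power I k"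
  unfolding ideal_power.simps ideal_prod_def
  by (rule ideal.span_minimal)
    (auto intro: ideal.subspace_scale[OF subspace_ideal_power] simp: subspace_ideal_power)

lemma ideal_power_antimono: "k \<le> l \<Longrightarrow> ideal_power I l \<subseteq> ideal_power I k"
  using ideal_power_Suc_subset by (rule lift_Suc_antimono_le)

lemma power_mem_ideal_power: "a \<in> I \<Longrightarrow> a ^ k \<in> ideal_power I k"
  by (induction k) (auto simp: ideal_prod_def intro!: ideal.span_base)

lemma subspace_mult_vimage:
  assumes "ideal.subspace J"
  shows "ideal.subspace {g. f * g \<in> J}"
  unfolding ideal.subspace_def
proof (intro conjI ballI allI)
  fix c g assume "g \<in> {g. f * g \<in> J}"
  then have "c * (f * g) \<in> J"
    using ideal.subspace_scale[OF assms] by blast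
  then show "c * g \<in> {g. f * g \<in> J}"
    by (subst (asm) mult.left_commute) blast
qed (use assms in \<open>auto simp: distrib_left ideal.subspace_0 ideal.subspace_add\<close>)

text \<open>With one factor fixed, the admissible other factors form an ideal
  (\<open>subspace_mult_vimage\<close>). This extends the hypothesis from generators to spans, first
  in \<open>B\<close>, then in \<open>A\<close>.\<close>

lemma span_mult_mem:
  assumes "a \<in> ideal.span A" "b \<in> ideal.span B"
    and AB: "\<And>x y. x \<in> A \<Longrightarrow> y \<in> B \<Longrightarrow> x * y \<in> J" and J: "ideal.subspace J"
  shows "a * b \<in> J"
proof -
  have "ideal.span B \<subseteq> {y. x * y \<in> J}" if "x \<in> A" for x
    using that AB by (intro ideal.span_minimal subspace_mult_vimage J) auto
  then have "ideal.span A \<subseteq> {x. b * x \<in> J}"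
    using assms(2) by (intro ideal.span_minimal subspace_mult_vimage J) (auto simp: mult.commute[of b])
  then show ?thesis
    using assms(1) by (auto simp: mult.commute[of b])
qed

section \<open>Colon ideals and the saturation number\<close>

text \<open>Makes the chain of colon ideals recursive: the colon by
  \<open>ideal_power M (Suc k)\<close> is the colon by \<open>M\<close> of the preceding
  member.\<close>

lemma ideal_colon_prod:
  assumes "ideal.subspace J"
  shows "ideal_colon J (ideal_prod A B) = ideal_colon (ideal_colon J B) A"
proof
  show "ideal_colon J (ideal_prod A B) \<subseteq> ideal_colon (ideal_colon J B) A"
  proof
    fix f assume f: "f \<in> ideal_colon J (ideal_prod A B)"
    have "f * a * b \<in> J" if "a \<in> A" "b \<in> B" for a b
    proof -
      have "a * b \<in> ideal_prod A B"
        unfolding ideal_prod_def using that by (intro ideal.span_base) blast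
      then have "f * (a * b) \<in> J"
        using f by (auto simp: ideal_colon_def)
      then show ?thesis by simp
    qed
    then show "f \<in> ideal_colon (ideal_colon J B) A"
      by (simp add: ideal_colon_def)
  qed
  show "ideal_colon (ideal_colon J B) A \<subseteq> ideal_colon J (ideal_prod A B)"
  proof
    fix f assume f: "f \<in> ideal_colon (ideal_colon J B) A"
    have "ideal.span {a * b | a b. a \<in> A \<and> b \<in> B} \<subseteq> {g. f * g \<in> J}"
    proof (rule ideal.span_minimal)
      show "{a * b | a b. a \<in> A \<and> b \<in> B} \<subseteq> {g. f * g \<in> J}"
        using f by (auto simp: ideal_colon_def)
    qed (rule subspace_mult_vimage[OF assms])
    then show "f \<in> ideal_colon J (ideal_prod A B)"
      by (auto simp: ideal_colon_def ideal_prod_def)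
  qed
qed

lemma ideal_colon_eq_UNIV_iff:
  assumes "ideal.subspace J"
  shows "ideal_colon J A = UNIV \<longleftrightarrow> A \<subseteq> J"
proof
  assume "ideal_colon J A = UNIV"
  then have "1 \<in> ideal_colon J A" by simp
  then show "A \<subseteq> J" by (auto simp: ideal_colon_def)
next
  assume "A \<subseteq> J"
  then show "ideal_colon J A = UNIV"
    using ideal.subspace_scale[OF assms] by (auto simp: ideal_colon_def)
qed

text \<open>By \<open>ideal_colon_prod\<close> each member of the chain determines the next, so a
  single repetition persists.\<close>

lemma ideal_colon_power_stable:
  assumes "ideal.subspace J"
    and "ideal_colon J (ideal_power M k) = ideal_colon J (ideal_power M (Suc k))"
  shows "ideal_colon J (ideal_power M (k + l)) = ideal_colon J (ideal_power M k)"
proof (induction l)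
  case (Suc l)
  have "ideal_colon J (ideal_power M (k + Suc l)) = ideal_colon J (ideal_power M (Suc k))"
    using Suc by (simp add: ideal_colon_prod[OF assms(1)])
  then show ?case using assms(2) by simp
qed simp

lemma sat_le_iff:
  assumes J: "ideal.subspace J" and N: "ideal_power max_ideal N \<subseteq> J"
  shows "sat J \<le> k \<longleftrightarrow> ideal_power max_ideal k \<subseteq> J"
proof -
  have stable_iff: "ideal_colon J (ideal_power max_ideal k) =
      ideal_colon J (ideal_power max_ideal (Suc k)) \<longleftrightarrow> ideal_power max_ideal k \<subseteq> J" for k
  proof
    assume "ideal_colon J (ideal_power max_ideal k) = ideal_colon J (ideal_power max_ideal (Suc k))"
    then have "ideal_colon J (ideal_power max_ideal (k + N)) =
        ideal_colon J (ideal_power max_ideal k)"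
      by (rule ideal_colon_power_stable[OF J])
    \<comment> \<open>So the colon at exponent \<open>k + N\<close> is the whole ring, and by
      stability so is the one at exponent \<open>k\<close>.\<close>
    moreover have "ideal_power max_ideal (k + N) \<subseteq> J"
      using N ideal_power_antimono[of N "k + N"] by fastforce
    ultimately show "ideal_power max_ideal k \<subseteq> J"
      by (simp add: ideal_colon_eq_UNIV_iff[OF J, symmetric])
  next
    assume k: "ideal_power max_ideal k \<subseteq> J"
    then have "ideal_power max_ideal (Suc k) \<subseteq> J"
      using ideal_power_Suc_subset by blast
    with k show "ideal_colon J (ideal_power max_ideal k) =
        ideal_colon J (ideal_power max_ideal (Suc k))"
      by (metis ideal_colon_eq_UNIV_iff[OF J])
  qed
  have sat: "sat J = (LEAST k. ideal_power max_ideal k \<subseteq> J)"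
    by (simp only: sat_def stable_iff)
  \<comment> \<open>\<open>N\<close> witnesses that the least exponent exists and is
    attained.\<close>
  have "ideal_power max_ideal (sat J) \<subseteq> J"
    unfolding sat by (rule LeastI[where P = "\<lambda>k. ideal_power max_ideal k \<subseteq> J", OF N])
  then show ?thesis
    using ideal_power_antimono[of "sat J" k] Least_le[of "\<lambda>k. ideal_power max_ideal k \<subseteq> J" k]
    unfolding sat by blast
qed

text \<open>Both sides have the same upper bounds: by \<open>sat_le_iff\<close>, \<open>k\<close>
  bounds either of them iff the \<open>k\<close>-th power of the maximal ideal lies in every
  \<open>J i\<close>.\<close>

lemma sat_Inter:
  assumes "finite A" "A \<noteq> {}" and J: "\<And>i. i \<in> A \<Longrightarrow> ideal.subspace (J i)"
    and N: "ideal_power max_ideal N \<subseteq> (\<Inter>i\<in>A. J i)"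
  shows "sat (\<Inter>i\<in>A. J i) = Max ((\<lambda>i. sat (J i)) ` A)"
proof -
  have "ideal.subspace (\<Inter>i\<in>A. J i)"
    using J by (auto intro: ideal.subspace_Inter)
  moreover have "sat (J i) \<le> k \<longleftrightarrow> ideal_power max_ideal k \<subseteq> J i" if "i \<in> A" for i k
    using that N by (intro sat_le_iff J) auto
  ultimately have "sat (\<Inter>i\<in>A. J i) \<le> k \<longleftrightarrow> Max ((\<lambda>i. sat (J i)) ` A) \<le> k" for k
    using assms by (auto simp: sat_le_iff[OF _ N])
  then show ?thesis by (meson antisym order_refl)
qed

section \<open>Monomials and powers of the maximal ideal\<close>

lemma monomial_mult: "monomial (m + m') = monomial m * monomial m'"
  by (simp add: monomial_def mult_single)

lemma Var_power: "Var i ^ c = monomial (Poly_Mapping.single i c)"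
proof (induction c)
  case 0
  show ?case by (simp add: monomial_def)
next
  case (Suc c)
  then show ?case by (simp add: Var_def flip: monomial_mult single_add)
qed

lemma monomial_mem_of_Var_power:
  fixes J :: "('n, 'k::field) mpoly set"
  assumes "ideal.subspace J" "Var i ^ c \<in> J" and c: "c \<le> Poly_Mapping.lookup m i"
  shows "monomial m \<in> J"
proof -
  \<comment> \<open>Subtraction of exponents is truncated; the bound on \<open>c\<close> keeps it
    exact at \<open>i\<close>.\<close>
  have "m = (m - Poly_Mapping.single i c) + Poly_Mapping.single i c"
    using c by (intro poly_mapping_eqI) (auto simp: lookup_add lookup_minus lookup_single when_def)
  then have "(monomial m :: ('n, 'k) mpoly) = monomial (m - Poly_Mapping.single i c) * Var i ^ c"
    by (metis Var_power monomial_mult)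
  then show ?thesis
    using ideal.subspace_scale[OF assms(1,2)] by simp
qed

text \<open>The polynomials \<open>?T\<close>, all of whose terms are divisible by some generator,
  form an ideal containing the generators, hence their span. A monomial has only one term to
  test.\<close>

lemma monomial_mem_span_Var_powers_iff:
  "monomial m \<in> ideal.span ((\<lambda>i. (Var i :: ('n::finite, 'k::field) mpoly) ^ c i) ` V) \<longleftrightarrow>
    (\<exists>i\<in>V. c i \<le> Poly_Mapping.lookup m i)"
proof
  let ?P = "\<lambda>m. \<exists>i\<in>V. c i \<le> Poly_Mapping.lookup m i"
  let ?T = "{f :: ('n, 'k) mpoly. \<forall>m\<in>Poly_Mapping.keys f. ?P m}"
  have "ideal.subspace ?T"
    unfolding ideal.subspace_def
  proof (intro conjI ballI allI)
    fix f g assume "f \<in> ?T" "g \<in> ?T"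
    then show "f + g \<in> ?T" using keys_add[of f g] by blast
  next
    fix f g assume g: "g \<in> ?T"
    have "?P m" if m: "m \<in> Poly_Mapping.keys (f * g)" for m
    proof -
      obtain a b where "m = a + b" "b \<in> Poly_Mapping.keys g"
        using m keys_mult[of f g] by blast
      with g obtain i where "i \<in> V" "c i \<le> Poly_Mapping.lookup b i" by blast
      then show ?thesis using \<open>m = a + b\<close> by (auto simp: lookup_add intro: trans_le_add2)
    qed
    then show "f * g \<in> ?T" by blast
  qed simp
  moreover have "(\<lambda>i. Var i ^ c i) ` V \<subseteq> ?T"
    by (force simp: Var_power monomial_def)
  ultimately have "ideal.span ((\<lambda>i. Var i ^ c i) ` V) \<subseteq> ?T"
    by (intro ideal.span_minimal)
  moreover assume "monomial m \<in> ideal.span ((\<lambda>i. (Var i :: ('n, 'k) mpoly) ^ c i) ` V)"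
  ultimately have "(monomial m :: ('n, 'k) mpoly) \<in> ?T" by blast
  then show "?P m" by (simp add: monomial_def)
next
  assume "\<exists>i\<in>V. c i \<le> Poly_Mapping.lookup m i"
  then obtain i where i: "i \<in> V" "c i \<le> Poly_Mapping.lookup m i" by blast
  then show "monomial m \<in> ideal.span ((\<lambda>i. (Var i :: ('n, 'k) mpoly) ^ c i) ` V)"
    by (intro monomial_mem_of_Var_power[OF ideal.subspace_span _ i(2)] ideal.span_base imageI)
qed

text \<open>Reduces containment of a power of the maximal ideal to monomials of one fixed degree;
  multiplying by a variable raises the degree by one.\<close>

lemma max_ideal_power_subset:
  "ideal_power max_ideal k \<subseteq> ideal.span {monomial m :: ('n::finite, 'k::field) mpoly | m.
     (\<Sum>i\<in>UNIV. Poly_Mapping.lookup m i) = k}" (is "_ \<subseteq> ideal.span (?D k)")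
proof (induction k)
  case 0
  have "1 \<in> ideal.span (?D 0)"
    by (rule ideal.span_base) (auto simp: monomial_def intro!: exI[of _ 0])
  then have "f * 1 \<in> ideal.span (?D 0)" for f
    by (rule ideal.span_scale)
  then show ?case by auto
next
  case (Suc k)
  have "a * b \<in> ideal.span (?D (Suc k))" if "a \<in> max_ideal" "b \<in> ideal_power max_ideal k" for a b
  proof (rule span_mult_mem)
    show "a \<in> ideal.span {Var i | i. True}"
      using that by (simp add: max_ideal_def)
    show "b \<in> ideal.span (?D k)"
      using that Suc by blast
    fix x y :: "('n, 'k) mpoly" assume "x \<in> {Var i | i. True}" "y \<in> ?D k"
    then obtain i m where "x = Var i" "y = monomial m"
      and m: "(\<Sum>i\<in>UNIV. Poly_Mapping.lookup m i) = k"
      by blast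
    then have "x * y = monomial (Poly_Mapping.single i 1 + m)"
      by (simp add: Var_def monomial_mult)
    moreover have "(\<Sum>j\<in>UNIV. Poly_Mapping.lookup (Poly_Mapping.single i 1 + m) j) = Suc k"
      by (simp add: lookup_add sum.distrib m lookup_single when_def)
    ultimately show "x * y \<in> ideal.span (?D (Suc k))"
      by (intro ideal.span_base) blast
  qed simp
  then show ?case
    unfolding ideal_power.simps ideal_prod_def by (intro ideal.span_minimal) auto
qed

lemma max_ideal_power_subset_of_radical:
  fixes J :: "('n::finite, 'k::field) mpoly set"
  assumes J: "ideal.subspace J" and "\<And>i. Var i \<in> radical J"
  obtains N where "ideal_power max_ideal N \<subseteq> J"
proof -
  from assms(2) obtain e where e: "\<And>i. Var i ^ e i \<in> J"
    unfolding radical_def mem_Collect_eq by metis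
  \<comment> \<open>Pigeonhole: a degree above the sum of all \<open>e i\<close> forces some
    exponent to exceed its \<open>e i\<close>.\<close>
  define N where "N = Suc (\<Sum>i\<in>UNIV. e i)"
  have "monomial m \<in> J" if "(\<Sum>i\<in>UNIV. Poly_Mapping.lookup m i) = N" for m
  proof -
    have "\<not> (\<forall>i. Poly_Mapping.lookup m i \<le> e i)"
      using that sum_mono[of UNIV "Poly_Mapping.lookup m" e] by (auto simp: N_def)
    then obtain i where "e i \<le> Poly_Mapping.lookup m i"
      by (meson nat_le_linear)
    then show ?thesis
      by (rule monomial_mem_of_Var_power[OF J e])
  qed
  then have "ideal.span {monomial m | m. (\<Sum>i\<in>UNIV. Poly_Mapping.lookup m i) = N} \<subseteq> J"
    by (intro ideal.span_minimal J) auto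
  then show thesis
    using max_ideal_power_subset that by blast
qed

section \<open>Uniqueness of irredundant irreducible decompositions\<close>

lemma irreducible_monomial_ideal_Inter_subset:
  fixes Q :: "('n::finite, 'k::field) mpoly set"
  assumes "finite A" "irreducible_monomial_ideal Q"
    and q: "\<And>j. j \<in> A \<Longrightarrow> irreducible_monomial_ideal (q j)"
    and sub: "(\<Inter>j\<in>A. q j) \<subseteq> Q"
  shows "\<exists>j\<in>A. q j \<subseteq> Q"
proof (rule ccontr)
  assume not_sub: "\<not> (\<exists>j\<in>A. q j \<subseteq> Q)"
  obtain V c where c: "\<And>i. i \<in> V \<Longrightarrow> 0 < c i" and Q: "Q = ideal.span ((\<lambda>i. Var i ^ c i) ` V)"
    using assms(2) unfolding irreducible_monomial_ideal_def by blast
  \<comment> \<open>If all generators of \<open>q j\<close> were in \<open>Q\<close>, so would be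
    \<open>q j\<close> itself.\<close>
  have "\<exists>i d. Var i ^ d \<in> q j \<and> Var i ^ d \<notin> Q" if j: "j \<in> A" for j
  proof -
    obtain W d where qj: "q j = ideal.span ((\<lambda>i. Var i ^ d i) ` W)"
      using q[OF j] unfolding irreducible_monomial_ideal_def by blast
    have "\<not> (\<lambda>i. Var i ^ d i) ` W \<subseteq> Q"
    proof
      assume "(\<lambda>i. Var i ^ d i) ` W \<subseteq> Q"
      then have "q j \<subseteq> Q"
        unfolding qj Q by (rule ideal.span_minimal[OF _ ideal.subspace_span])
      then show False using not_sub j by blast
    qed
    then obtain i where i: "i \<in> W" "Var i ^ d i \<notin> Q" by blast
    have "Var i ^ d i \<in> q j"
      unfolding qj by (intro ideal.span_base imageI i)
    with i show ?thesis by blast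
  qed
  then obtain v d where v: "\<And>j. j \<in> A \<Longrightarrow> Var (v j) ^ d j \<in> q j"
    and v_notin: "\<And>j. j \<in> A \<Longrightarrow> Var (v j) ^ d j \<notin> Q"
    by metis
  \<comment> \<open>The monomial \<open>u\<close> lies outside \<open>Q\<close>, but all the \<open>Var (v j) ^ d j\<close> divide it.\<close>
  define u where "u = Abs_poly_mapping (\<lambda>i. if i \<in> V then c i - 1 else \<Sum>j\<in>A. d j)"
  have u: "Poly_Mapping.lookup u i = (if i \<in> V then c i - 1 else \<Sum>j\<in>A. d j)" for i
    by (simp add: u_def)
  have "monomial u \<in> q j" if j: "j \<in> A" for j
  proof -
    have "\<not> c i \<le> Poly_Mapping.lookup (Poly_Mapping.single (v j) (d j)) i" if "i \<in> V" for i
      using v_notin[OF j] that unfolding Q Var_power[of _ "d j"] monomial_mem_span_Var_powers_iff by blast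
    from this[of "v j"] have "d j < c (v j)" if "v j \<in> V"
      using that by simp
    \<comment> \<open>For \<open>v j\<close> in \<open>V\<close>, the exponent
      \<open>c (v j) - 1\<close> is the largest one allowed outside \<open>Q\<close>, and the strict
      bound suffices. Other variables are unconstrained by \<open>Q\<close>, so there the sum over
      \<open>A\<close> dominates every \<open>d j\<close>.\<close>
    then have "d j \<le> Poly_Mapping.lookup u (v j)"
      using member_le_sum[OF j, of d] \<open>finite A\<close> by (auto simp: u)
    moreover have "ideal.subspace (q j)"
      using q[OF j] by (auto simp: irreducible_monomial_ideal_def)
    ultimately show ?thesis
      by (intro monomial_mem_of_Var_power[OF _ v[OF j]])
  qed
  then have "monomial u \<in> Q" using sub by blast
  then obtain i where "i \<in> V" "c i \<le> Poly_Mapping.lookup u i"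
    by (auto simp: Q monomial_mem_span_Var_powers_iff)
  \<comment> \<open>Positivity of \<open>c i\<close> makes the truncated \<open>c i - 1\<close>
    strictly smaller than \<open>c i\<close>.\<close>
  then show False using c[of i] by (simp add: u)
qed

text \<open>Going to the other decomposition and back gives \<open>q l\<close> inside
  \<open>q' j\<close> inside \<open>q i\<close>; irredundancy collapses this to an equality. Applied
  in both directions, it yields the same set of components.\<close>

lemma irredundant_irreducible_decomp_components_subset:
  assumes q: "irredundant_irreducible_decomp I r q" and q': "irredundant_irreducible_decomp I r' q'"
  shows "q ` {1..r} \<subseteq> q' ` {1..r'}"
proof
  fix Q assume "Q \<in> q ` {1..r}"
  then obtain i where i: "i \<in> {1..r}" and Q: "Q = q i" by blast
  have irr: "\<And>j. j \<in> {1..r} \<Longrightarrow> irreducible_monomial_ideal (q j)" "I = (\<Inter>j\<in>{1..r}. q j)"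
    "\<And>j. j \<in> {1..r} \<Longrightarrow> (\<Inter>i\<in>{1..r} - {j}. q i) \<noteq> I"
    using q unfolding irredundant_irreducible_decomp_def by blast+
  have irr': "\<And>j. j \<in> {1..r'} \<Longrightarrow> irreducible_monomial_ideal (q' j)" "I = (\<Inter>j\<in>{1..r'}. q' j)"
    using q' unfolding irredundant_irreducible_decomp_def by blast+
  have "(\<Inter>j\<in>{1..r'}. q' j) \<subseteq> q i"
    unfolding irr'(2)[symmetric] irr(2) using i by (rule INT_lower)
  then have "\<exists>j\<in>{1..r'}. q' j \<subseteq> q i"
    by (intro irreducible_monomial_ideal_Inter_subset irr(1) irr'(1) i) simp_all
  then obtain j where j: "j \<in> {1..r'}" "q' j \<subseteq> q i" by blast
  have "(\<Inter>j\<in>{1..r}. q j) \<subseteq> q' j"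
    unfolding irr(2)[symmetric] irr'(2) using j(1) by (rule INT_lower)
  then have "\<exists>l\<in>{1..r}. q l \<subseteq> q' j"
    by (intro irreducible_monomial_ideal_Inter_subset irr(1) irr'(1) j(1)) simp_all
  then obtain l where l: "l \<in> {1..r}" "q l \<subseteq> q' j" by blast
  have "l = i"
  proof (rule ccontr)
    assume "l \<noteq> i"
    \<comment> \<open>The component \<open>q l\<close> remains when \<open>q i\<close> is removed,
      so \<open>q i\<close> could be omitted.\<close>
    then have "(\<Inter>j\<in>{1..r} - {i}. q j) \<subseteq> q i" using l j by blast
    then have "(\<Inter>j\<in>{1..r} - {i}. q j) = I" unfolding irr(2) by blast
    then show False using irr(3) i by blast
  qed
  then show "Q \<in> q' ` {1..r'}" using l j Q by blast
qed

section \<open>Saturation of the symbolic power\<close>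

lemma symbolic_power_eq:
  assumes "irredundant_irreducible_decomp I r q"
  shows "symbolic_power I k = (\<Inter>i\<in>{1..r}. ideal_power (q i) k)"
  unfolding symbolic_power_def
proof (rule the_equality)
  fix J assume "\<exists>r q. irredundant_irreducible_decomp I r q \<and> J = (\<Inter>i\<in>{1..r}. ideal_power (q i) k)"
  then obtain r' q' where q': "irredundant_irreducible_decomp I r' q'"
    and J: "J = (\<Inter>i\<in>{1..r'}. ideal_power (q' i) k)" by blast
  have "q' ` {1..r'} = q ` {1..r}"
    using irredundant_irreducible_decomp_components_subset assms q' by (metis subset_antisym)
  \<comment> \<open>Intersecting over the set of components makes the result independent of their
    numbering.\<close>
  then have "(\<Inter>Q\<in>q' ` {1..r'}. ideal_power Q k) = (\<Inter>Q\<in>q ` {1..r}. ideal_power Q k)"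
    by simp
  then show "J = (\<Inter>i\<in>{1..r}. ideal_power (q i) k)"
    by (simp add: J image_image)
qed (use assms in blast)

theorem proposition2p6:
  fixes I :: "('n::finite, 'k::field) mpoly set"
    and q :: "nat \<Rightarrow> ('n, 'k) mpoly set"
    and r k :: nat
  assumes "monomial_ideal I"
    and "max_ideal_primary I"
    and "irredundant_irreducible_decomp I r q"
    and "k \<ge> 1"
  shows "sat (symbolic_power I k) = Max ((\<lambda>i. sat (ideal_power (q i) k)) ` {1..r})
       \<and> Max ((\<lambda>i. sat (ideal_power (q i) k)) ` {1..r}) \<le> sat (ideal_power I k)"
proof -
  have I: "I \<noteq> UNIV" "radical I = max_ideal"
    using assms(2) unfolding max_ideal_primary_def primary_ideal_def by blast+
  have I_eq: "I = (\<Inter>i\<in>{1..r}. q i)"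
    using assms(3) by (simp add: irredundant_irreducible_decomp_def)
  \<comment> \<open>For \<open>r = 0\<close> the intersection would be the whole ring, but
    \<open>I\<close> is proper; so \<open>Max\<close> is taken over a nonempty set.\<close>
  then have ne: "{1..r} \<noteq> {}" using I(1) by force
  have "Var i \<in> radical (ideal_power I k)" for i
  proof -
    have "Var i \<in> max_ideal"
      unfolding max_ideal_def by (rule ideal.span_base) blast
    then obtain e where "Var i ^ e \<in> I" using I(2) by (auto simp: radical_def)
    then have "Var i ^ (e * k) \<in> ideal_power I k"
      unfolding power_mult by (rule power_mem_ideal_power)
    then show ?thesis by (auto simp: radical_def)
  qed
  then obtain N where N: "ideal_power max_ideal N \<subseteq> ideal_power I k"
    using max_ideal_power_subset_of_radical subspace_ideal_power by blast
  have sub: "ideal_power I k \<subseteq> ideal_power (q i) k" if "i \<in> {1..r}" for i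
    using that by (intro ideal_power_mono) (auto simp: I_eq)
  \<comment> \<open>The exponent \<open>N\<close> found for \<open>ideal_power I k\<close> serves
    all components at once.\<close>
  have "ideal_power max_ideal N \<subseteq> (\<Inter>i\<in>{1..r}. ideal_power (q i) k)"
    using N sub by blast
  then have "sat (symbolic_power I k) = Max ((\<lambda>i. sat (ideal_power (q i) k)) ` {1..r})"
    unfolding symbolic_power_eq[OF assms(3)]
    by (intro sat_Inter ne subspace_ideal_power) simp_all
  moreover have "sat (ideal_power (q i) k) \<le> sat (ideal_power I k)" if i: "i \<in> {1..r}" for i
  proof -
    \<comment> \<open>The criterion at its own saturation number; this containment passes on to the
      larger ideal \<open>ideal_power (q i) k\<close>.\<close>
    have "ideal_power max_ideal (sat (ideal_power I k)) \<subseteq> ideal_power I k"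
      using sat_le_iff[OF subspace_ideal_power N] by blast
    then show ?thesis
      using sat_le_iff[OF subspace_ideal_power, of N "q i" k] N sub[OF i] by blast
  qed
  ultimately show ?thesis using ne by simp
qed

end
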